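(* Let $X$ be a real Banach space with continuous dual $X^*$. Let $A\colon X\rightrightarrows X^*$ be a maximal monotone linear relation, let $C$ be a nonempty closed convex subset of $X$, and suppose that $\operatorname{dom} A\cap\operatorname{int} C\neq\varnothing$. Then $A+N_C$ is maximal monotone.
   Context: $\langle\cdot,\cdot\rangle$ denotes the pairing between $X$ and $X^*$. For a set-valued operator $A\colon X\rightrightarrows X^*$, $\operatorname{gra}A=\{(x,x^* )\in X\times X^*: x^*\in Ax\}$ and $\operatorname{dom}A=\{x: Ax\neq\varnothing\}$. $A$ is monotone if $\langle x-y,x^*-y^*\rangle\ge 0$ for all $(x,x^* ),(y,y^* )\in\operatorname{gra}A$, and maximal monotone if it is monotone and no monotone operator has a graph properly containing $\operatorname{gra}A$. $A$ is a linear relation if $\operatorname{gra}A$ is a linear subspace of $X\times X^*$. The normal cone operator of $C$ is $N_C(x)=\{x^*\in X^*:\sup_{c\in C}\langle c-x,x^*\rangle\le 0\}$ if $x\in C$ and $N_C(x)=\varnothing$ otherwise. The sum is $(A+N_C)x=\{a^*+b^*: a^*\in Ax,\ b^*\in N_C(x)\}$. $\operatorname{int}C$ is the interior of $C$. *)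

theory Defs
  imports "HOL-Analysis.Analysis"
begin

definition pairing :: "'a::real_normed_vector \<Rightarrow> ('a \<Rightarrow>\<^sub>L real) \<Rightarrow> real" where
  "pairing x xs = blinfun_apply xs x"

definition gra :: "('a \<Rightarrow> 'b set) \<Rightarrow> ('a \<times> 'b) set" where
  "gra A = {(x, xs). xs \<in> A x}"

definition dom_op :: "('a \<Rightarrow> 'b set) \<Rightarrow> 'a set" where
  "dom_op A = {x. A x \<noteq> {}}"

definition monotone_op :: "('a::real_normed_vector \<Rightarrow> ('a \<Rightarrow>\<^sub>L real) set) \<Rightarrow> bool" where
  "monotone_op A \<longleftrightarrow>
     (\<forall>x xs y ys. (x, xs) \<in> gra A \<and> (y, ys) \<in> gra A \<longrightarrow> pairing (x - y) (xs - ys) \<ge> 0)"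

definition maximal_monotone :: "('a::real_normed_vector \<Rightarrow> ('a \<Rightarrow>\<^sub>L real) set) \<Rightarrow> bool" where
  "maximal_monotone A \<longleftrightarrow> monotone_op A \<and>
     (\<forall>B. monotone_op B \<and> gra A \<subseteq> gra B \<longrightarrow> gra B = gra A)"

definition linear_relation :: "('a::real_normed_vector \<Rightarrow> ('a \<Rightarrow>\<^sub>L real) set) \<Rightarrow> bool" where
  "linear_relation A \<longleftrightarrow> subspace (gra A)"

definition normal_cone :: "'a::real_normed_vector set \<Rightarrow> 'a \<Rightarrow> ('a \<Rightarrow>\<^sub>L real) set" where
  "normal_cone C x = (if x \<in> C then {xs. \<forall>c\<in>C. pairing (c - x) xs \<le> 0} else {})"

definition op_sum :: "('a \<Rightarrow> 'b::plus set) \<Rightarrow> ('a \<Rightarrow> 'b set) \<Rightarrow> 'a \<Rightarrow> 'b set" where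
  "op_sum A B x = {as + bs | as bs. as \<in> A x \<and> bs \<in> B x}"

end

theory Submission
  imports Defs
begin

text \<open>Translating by a point of \<open>gra A\<close> over \<open>int C\<close>, which leaves \<open>gra A\<close> unchanged because it is a
  subspace, one may assume \<open>0 \<in> int C\<close>. Let \<open>(z, zs)\<close> be monotonically related to \<open>A + N\<^sub>C\<close>. Testing
  with \<open>A 0\<close>, which is the annihilator of \<open>dom A\<close>, gives \<open>z \<in> cl (dom A)\<close>; testing with normals at boundary
  points of \<open>C\<close> in \<open>dom A\<close> then gives \<open>z \<in> C\<close>. Finally, \<open>(a, as) \<mapsto> \<langle>z - a, zs - as\<rangle>\<close> is convex on
  \<open>gra A\<close> and nonnegative where \<open>a \<in> C\<close>, so Hahn--Banach yields a functional \<open>f\<close> with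
  \<open>f (c - a) \<le> \<langle>z - a, zs - as\<rangle>\<close> for all \<open>c \<in> C\<close> and \<open>(a, as) \<in> gra A\<close>; taking \<open>c = z\<close> and using the
  maximality of \<open>A\<close> gives \<open>zs - f \<in> A z\<close>, and then taking \<open>a = z\<close> gives \<open>f \<in> N\<^sub>C z\<close>.\<close>

section \<open>Hahn-Banach: linear functionals below sublinear ones\<close>

text \<open>Minimal sublinear functionals are linear, so Zorn's lemma gives Hahn--Banach.\<close>

definition sublinear :: "('a::real_vector \<Rightarrow> real) \<Rightarrow> bool" where
  "sublinear p \<longleftrightarrow>
     (\<forall>x y. p (x + y) \<le> p x + p y) \<and> (\<forall>t>0. \<forall>x. p (t *\<^sub>R x) = t * p x)"

text \<open>The reverse inequality is the assumed one applied to \<open>t *\<^sub>R x\<close> with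
  factor \<open>1 / t\<close>.\<close>

lemma sublinearI:
  assumes "\<And>x y. p (x + y) \<le> p x + p y"
    and ge: "\<And>t x. t > 0 \<Longrightarrow> p (t *\<^sub>R x) \<ge> t * p x"
  shows "sublinear p"
proof -
  have "p (t *\<^sub>R x) \<le> t * p x" if "t > 0" for t x
    using ge[of "1 / t" "t *\<^sub>R x"] that by (simp add: field_simps)
  with assms show ?thesis
    unfolding sublinear_def by (meson order_antisym)
qed

lemma sublinear_add: "sublinear p \<Longrightarrow> p (x + y) \<le> p x + p y"
  by (simp add: sublinear_def)

lemma sublinear_scale: "sublinear p \<Longrightarrow> t > 0 \<Longrightarrow> p (t *\<^sub>R x) = t * p x"
  by (simp add: sublinear_def)

lemma sublinear_0: "sublinear p \<Longrightarrow> p 0 = 0"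
  using sublinear_scale[of p 2 0] by simp

lemma sublinear_minus_ge: "sublinear p \<Longrightarrow> - p (- x) \<le> p x"
  using sublinear_add[of p x "- x"] sublinear_0[of p] by simp

text \<open>Zorn's lemma is applied in the reversed pointwise order. A nonempty chain is bounded by
  its pointwise infimum, which is finite because every sublinear \<open>q \<le> p\<close> satisfies
  \<open>- p (- x) \<le> q x\<close>.\<close>

lemma minimal_sublinear_exists:
  assumes p: "sublinear p"
  obtains q where "sublinear q" "q \<le> p"
    "\<And>r. sublinear r \<Longrightarrow> r \<le> q \<Longrightarrow> r = q"
proof -
  define F where "F = {q. sublinear q \<and> q \<le> p}"
  have "\<exists>m\<in>F. \<forall>a\<in>F. m \<ge> a \<longrightarrow> a = m"
  proof (rule predicate_Zorn)
    show "partial_order_on F (relation_of (\<ge>) F)"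
      by (rule partial_order_on_relation_ofI) auto
  next
    fix K assume "K \<in> Chains (relation_of (\<ge>) F)"
    then have KF: "K \<subseteq> F" and chain: "\<And>a b. a \<in> K \<Longrightarrow> b \<in> K \<Longrightarrow> a \<ge> b \<or> b \<ge> a"
      by (auto simp: Chains_def relation_of_def)
    show "\<exists>u\<in>F. \<forall>a\<in>K. a \<ge> u"
    proof (cases "K = {}")
      case True
      then show ?thesis using p by (auto simp: F_def)
    next
      case False
      define L where "L x = (INF q\<in>K. q x)" for x
      have sub: "sublinear q" if "q \<in> K" for q
        using that KF by (auto simp: F_def)
      have "- p (- x) \<le> q x" if "q \<in> K" for q x
      proof -
        have "q (- x) \<le> p (- x)"
          using that KF by (auto simp: F_def le_fun_def)
        then show ?thesis
          using sublinear_minus_ge[OF sub[OF that], of x] by linarith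
      qed
      then have bdd: "bdd_below ((\<lambda>q. q x) ` K)" for x
        by (auto simp: bdd_below_def)
      have L_le: "L x \<le> q x" if "q \<in> K" for q x
        unfolding L_def by (rule cINF_lower[OF bdd that])
      have L_ge: "c \<le> L x" if "\<And>q. q \<in> K \<Longrightarrow> c \<le> q x" for c x
        unfolding L_def using False that by (rule cINF_greatest)
      have "sublinear L"
      proof (rule sublinearI)
        fix x y
        \<comment> \<open>The infima at \<open>x\<close> and at \<open>y\<close> run over
          independent members of the chain; the smaller of two members serves both
          arguments.\<close>
        have both: "L (x + y) \<le> q1 x + q2 y" if q12: "q1 \<in> K" "q2 \<in> K" for q1 q2
        proof -
          obtain q where q: "q \<in> K" "q \<le> q1" "q \<le> q2"
            using chain[OF q12] q12 by blast
          have "L (x + y) \<le> q x + q y"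
            using L_le[OF q(1), of "x + y"] sublinear_add[OF sub[OF q(1)], of x y] by linarith
          also have "\<dots> \<le> q1 x + q2 y"
            using q by (intro add_mono) (auto simp: le_fun_def)
          finally show ?thesis .
        qed
        have "L (x + y) - q2 y \<le> L x" if "q2 \<in> K" for q2
          by (rule L_ge) (use both that in \<open>simp add: algebra_simps\<close>)
        then have "L (x + y) - L x \<le> L y"
          by (intro L_ge) (simp add: algebra_simps)
        then show "L (x + y) \<le> L x + L y" by simp
      next
        fix t :: real and x assume "t > 0"
        then show "t * L x \<le> L (t *\<^sub>R x)"
          by (intro L_ge) (simp add: sublinear_scale sub L_le)
      qed
      moreover have "L \<le> p"
      proof -
        obtain q where q: "q \<in> K" using False by blast
        then have "q \<le> p" using KF by (auto simp: F_def)
        then show ?thesis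
          using order_trans[OF L_le[OF q]] by (auto simp: le_fun_def)
      qed
      ultimately show ?thesis
        using L_le by (auto simp: F_def le_fun_def)
    qed
  qed
  then obtain m where "m \<in> F" and m: "\<And>a. a \<in> F \<Longrightarrow> a \<le> m \<Longrightarrow> a = m"
    by blast
  then show ?thesis
    by (intro that[of m]) (auto simp: F_def intro: order_trans)
qed

text \<open>The competitor \<open>r\<close> lowers \<open>q\<close> along the direction
  \<open>y\<close>. It is sublinear and below \<open>q\<close>, so minimality forces
  \<open>r = q\<close>, and the parameter \<open>t = 1\<close> in the infimum gives the
  inequality.\<close>

lemma minimal_sublinear_superadditive:
  assumes q: "sublinear q" and min: "\<And>r. sublinear r \<Longrightarrow> r \<le> q \<Longrightarrow> r = q"
  shows "q x + q y \<le> q (x + y)"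
proof -
  define r where "r x = (INF t\<in>{0::real..}. q (x + t *\<^sub>R y) - t * q y)" for x
  have scale: "q (t *\<^sub>R y) = t * q y" if "t \<ge> 0" for t
    using that sublinear_0[OF q] sublinear_scale[OF q, of t y] by (cases "t = 0") auto
  \<comment> \<open>This lower bound does not depend on \<open>t\<close>, so the infimum defining
    \<open>r\<close> is finite.\<close>
  have "- q (- x) \<le> q (x + t *\<^sub>R y) - t * q y" if "t \<ge> 0" for t x
    using sublinear_add[OF q, of "x + t *\<^sub>R y" "- x"] scale[OF that] by simp
  then have bdd: "bdd_below ((\<lambda>t. q (x + t *\<^sub>R y) - t * q y) ` {0..})" for x
    by (auto simp: bdd_below_def)
  have r_le: "r x \<le> q (x + t *\<^sub>R y) - t * q y" if "t \<ge> 0" for t x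
    unfolding r_def by (rule cINF_lower[OF bdd]) (use that in simp)
  have r_ge: "c \<le> r x" if "\<And>t. t \<ge> 0 \<Longrightarrow> c \<le> q (x + t *\<^sub>R y) - t * q y" for c x
    unfolding r_def by (rule cINF_greatest) (use that in auto)
  have "sublinear r"
  proof (rule sublinearI)
    fix u v
    have both: "r (u + v) \<le> (q (u + s *\<^sub>R y) - s * q y) + (q (v + t *\<^sub>R y) - t * q y)"
      if "s \<ge> 0" "t \<ge> 0" for s t
    proof -
      have eq: "u + v + (s + t) *\<^sub>R y = (u + s *\<^sub>R y) + (v + t *\<^sub>R y)"
        by (simp add: algebra_simps)
      have "r (u + v) \<le> q (u + v + (s + t) *\<^sub>R y) - (s + t) * q y"
        using that by (intro r_le) simp
      then show ?thesis
        unfolding eq using sublinear_add[OF q, of "u + s *\<^sub>R y" "v + t *\<^sub>R y"]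
        by (simp add: algebra_simps)
    qed
    have "r (u + v) - (q (v + t *\<^sub>R y) - t * q y) \<le> r u" if "t \<ge> 0" for t
      by (rule r_ge) (use both that in \<open>simp add: algebra_simps\<close>)
    then have "r (u + v) - r u \<le> r v"
      by (intro r_ge) (simp add: algebra_simps)
    then show "r (u + v) \<le> r u + r v" by simp
  next
    fix s :: real and u assume s: "s > 0"
    show "s * r u \<le> r (s *\<^sub>R u)"
    proof (rule r_ge)
      fix t :: real assume t: "t \<ge> 0"
      have "s *\<^sub>R u + t *\<^sub>R y = s *\<^sub>R (u + (t / s) *\<^sub>R y)"
        using s by (simp add: algebra_simps)
      then have "q (s *\<^sub>R u + t *\<^sub>R y) = s * q (u + (t / s) *\<^sub>R y)"
        using s by (simp add: sublinear_scale[OF q])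
      moreover have "s * r u \<le> s * (q (u + (t / s) *\<^sub>R y) - t / s * q y)"
        using r_le[of "t / s" u] s t by (intro mult_left_mono) auto
      ultimately show "s * r u \<le> q (s *\<^sub>R u + t *\<^sub>R y) - t * q y"
        using s by (simp add: algebra_simps)
    qed
  qed
  moreover have "r \<le> q"
    using r_le[of 0] by (simp add: le_fun_def)
  ultimately have "r = q" by (rule min)
  then show ?thesis
    using r_le[of 1 x] by simp
qed

text \<open>Minimality makes \<open>q\<close> additive, hence odd, and oddness carries homogeneity
  over to negative scalars.\<close>

lemma linear_below_sublinear:
  assumes "sublinear p"
  obtains f where "linear f" "f \<le> p"
proof -
  obtain q where q: "sublinear q" "q \<le> p" "\<And>r. sublinear r \<Longrightarrow> r \<le> q \<Longrightarrow> r = q"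
    using minimal_sublinear_exists[OF assms] by blast
  have add: "q (x + y) = q x + q y" for x y
    using sublinear_add[OF q(1), of x y] minimal_sublinear_superadditive[OF q(1,3), of x y]
    by simp
  have neg: "q (- x) = - q x" for x
    using add[of x "- x"] sublinear_0[OF q(1)] by simp
  have "q (t *\<^sub>R x) = t * q x" for t x
  proof (cases t "0::real" rule: linorder_cases)
    case less
    then show ?thesis
      using sublinear_scale[OF q(1), of "- t" x] neg[of "t *\<^sub>R x"] by simp
  qed (use q(1) in \<open>auto simp: sublinear_0 sublinear_scale\<close>)
  then have "linear q"
    using add by (intro linearI) auto
  with q(2) show ?thesis by (rule that[rotated -1])
qed

section \<open>Supporting functionals of convex sets\<close>

text \<open>The functional lies below the positively homogeneous hull
  \<open>x \<mapsto> inf {t r | t > 0, (x / t, r) \<in> S}\<close>.\<close>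

lemma convex_nonvertical_support:
  fixes S :: "('a::real_normed_vector \<times> real) set"
  assumes S: "convex S" and nonneg: "\<And>r. (0, r) \<in> S \<Longrightarrow> r \<ge> 0"
    and \<delta>: "\<delta> > 0" and ball: "\<And>x. norm x < \<delta> \<Longrightarrow> (x, M) \<in> S"
  shows "\<exists>f :: 'a \<Rightarrow>\<^sub>L real. \<forall>(x, r)\<in>S. blinfun_apply f x \<le> r"
proof -
  define V where "V x = {t * r | t r. t > 0 \<and> ((1 / t) *\<^sub>R x, r) \<in> S}" for x
  define P where "P x = Inf (V x)" for x
  have V_add: "v + w \<in> V (x + y)" if "v \<in> V x" "w \<in> V y" for v w x y
  proof -
    from that obtain t r s r' where *: "v = t * r" "t > 0" "((1 / t) *\<^sub>R x, r) \<in> S"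
      "w = s * r'" "s > 0" "((1 / s) *\<^sub>R y, r') \<in> S"
      by (auto simp: V_def)
    \<comment> \<open>These weights merge the dilations by \<open>t\<close> and by \<open>s\<close>
      into a single dilation by \<open>t + s\<close>; convexity of \<open>S\<close> thus becomes
      subadditivity.\<close>
    have "(t / (t + s)) *\<^sub>R ((1 / t) *\<^sub>R x, r) + (s / (t + s)) *\<^sub>R ((1 / s) *\<^sub>R y, r') \<in> S"
      using * by (intro convexD[OF S]) (auto simp flip: add_divide_distrib)
    also have "(t / (t + s)) *\<^sub>R ((1 / t) *\<^sub>R x, r) + (s / (t + s)) *\<^sub>R ((1 / s) *\<^sub>R y, r')
      = ((1 / (t + s)) *\<^sub>R (x + y), (t * r + s * r') / (t + s))"
      using * by (auto simp: scaleR_add_right add_divide_distrib)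
    finally have "((1 / (t + s)) *\<^sub>R (x + y), (t * r + s * r') / (t + s)) \<in> S" .
    with * show ?thesis
      unfolding V_def
      by (intro CollectI exI[of _ "t + s"] exI[of _ "(t * r + s * r') / (t + s)"]) auto
  qed
  have V_norm: "t * M \<in> V x" if "t > 0" "norm x < t * \<delta>" for t x
    unfolding V_def using that
    by (intro CollectI exI[of _ t] exI[of _ M] conjI ball refl) (simp_all add: field_simps)
  have V_0: "v \<ge> 0" if "v \<in> V 0" for v
    using that nonneg by (auto simp: V_def)
  have V_mem: "\<exists>t>0. t * M \<in> V x" for x
  proof -
    have "norm x < ((norm x + 1) / \<delta>) * \<delta>" using \<delta> by simp
    moreover have "(norm x + 1) / \<delta> > 0"
      using \<delta> by (simp add: add_nonneg_pos)
    ultimately show ?thesis using V_norm by blast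
  qed
  have V_ne: "V x \<noteq> {}" for x using V_mem by blast
  have bdd: "bdd_below (V x)" for x
  proof -
    \<comment> \<open>Adding an element of \<open>V (- x)\<close> to \<open>v\<close> lands in
      \<open>V 0\<close>, which has no negative members.\<close>
    obtain t where "t * M \<in> V (- x)" using V_mem by blast
    then have "- (t * M) \<le> v" if "v \<in> V x" for v
      using V_0[of "v + t * M"] V_add[OF that] by fastforce
    then show ?thesis by (auto simp: bdd_below_def)
  qed
  have P_le: "P x \<le> v" if "v \<in> V x" for v x
    unfolding P_def using that bdd by (rule cInf_lower)
  have P_ge: "c \<le> P x" if "\<And>v. v \<in> V x \<Longrightarrow> c \<le> v" for c x
    unfolding P_def using V_ne that by (rule cInf_greatest)
  have "sublinear P"
  proof (rule sublinearI)
    fix x y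
    have "P (x + y) - w \<le> P x" if "w \<in> V y" for w
      by (rule P_ge) (use P_le[OF V_add] that in \<open>fastforce simp: algebra_simps\<close>)
    then have "P (x + y) - P x \<le> P y"
      by (intro P_ge) (simp add: algebra_simps)
    then show "P (x + y) \<le> P x + P y" by simp
  next
    fix s :: real and x assume s: "s > 0"
    show "s * P x \<le> P (s *\<^sub>R x)"
    proof (rule P_ge)
      fix v assume "v \<in> V (s *\<^sub>R x)"
      then obtain t r where tr: "v = t * r" "t > 0" "((1 / t) *\<^sub>R s *\<^sub>R x, r) \<in> S"
        by (auto simp: V_def)
      then have "(t / s) * r \<in> V x"
        using s unfolding V_def
        by (intro CollectI exI[of _ "t / s"] exI[of _ r]) auto
      then have "s * P x \<le> s * ((t / s) * r)"
        using s by (intro mult_left_mono P_le) auto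
      then show "s * P x \<le> v" using s tr by simp
    qed
  qed
  then obtain f where f: "linear f" "f \<le> P" by (rule linear_below_sublinear)
  have f_le: "f x \<le> v" if "v \<in> V x" for v x
    using f(2) P_le[OF that] by (auto simp: le_fun_def intro: order_trans)
  have f_norm: "f x \<le> norm x * (2 * \<bar>M\<bar> / \<delta>)" for x
  proof (cases "x = 0")
    case False
    \<comment> \<open>The dilation \<open>t = norm x * 2 / \<delta>\<close> satisfies
      \<open>norm x < t * \<delta>\<close> because \<open>x\<close> is nonzero.\<close>
    then have "f x \<le> (norm x * 2 / \<delta>) * M"
      using \<delta> by (intro f_le V_norm) auto
    also have "\<dots> \<le> (norm x * 2 / \<delta>) * \<bar>M\<bar>"
      using \<delta> by (intro mult_left_mono) auto
    finally show ?thesis by simp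
  qed (simp add: linear_0[OF f(1)])
  have "bounded_linear f"
  proof (rule bounded_linear_intro)
    show "norm (f x) \<le> norm x * (2 * \<bar>M\<bar> / \<delta>)" for x
      using f_norm[of x] f_norm[of "- x"] by (simp add: linear_neg[OF f(1)] abs_le_iff)
  qed (simp_all add: linear_add[OF f(1)] linear_scale[OF f(1)])
  moreover have "f x \<le> r" if "(x, r) \<in> S" for x r
    by (rule f_le, unfold V_def, rule CollectI, intro exI[of _ 1] exI[of _ r]) (use that in simp)
  ultimately show ?thesis
    by (intro exI[of _ "Blinfun f"]) (auto simp: bounded_linear_Blinfun_apply)
qed

text \<open>The heights in \<open>S\<close> charge \<open>s\<close> for the multiple of
  \<open>z\<close> and \<open>norm b / \<delta>\<close> for the error \<open>b\<close>. A functional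
  supporting \<open>S\<close> is at most 0 on the subspace \<open>D\<close>, hence zero there, and
  the points \<open>(z, 1)\<close> and \<open>(- z, - 1)\<close> pin its value at
  \<open>z\<close>.\<close>

lemma annihilator_separates:
  fixes D :: "'a::real_normed_vector set"
  assumes D: "subspace D" and z: "z \<notin> closure D"
  obtains f :: "'a \<Rightarrow>\<^sub>L real" where "\<And>d. d \<in> D \<Longrightarrow> blinfun_apply f d = 0" "blinfun_apply f z = 1"
proof -
  obtain \<delta> where \<delta>: "\<delta> > 0" and far: "\<And>d. d \<in> D \<Longrightarrow> norm (d - z) \<ge> \<delta>"
    using z unfolding closure_approachable dist_norm by (meson not_le)
  define S where "S = {(d + s *\<^sub>R z + b, r) | d s b r. d \<in> D \<and> s + norm b / \<delta> \<le> r}"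
  have SI: "(d + s *\<^sub>R z + b, r) \<in> S" if "d \<in> D" "s + norm b / \<delta> \<le> r" for d s b r
    using that by (auto simp: S_def)
  have D0: "0 \<in> D" by (rule subspace_0[OF D])
  have "convex S"
  proof (rule convexI)
    fix p q u v assume "p \<in> S" "q \<in> S" and uv: "0 \<le> u" "0 \<le> v" "u + v = (1::real)"
    then obtain d s b r d' s' b' r' where p: "p = (d + s *\<^sub>R z + b, r)" "d \<in> D" "s + norm b / \<delta> \<le> r"
      and q: "q = (d' + s' *\<^sub>R z + b', r')" "d' \<in> D" "s' + norm b' / \<delta> \<le> r'"
      by (auto simp: S_def)
    have "norm (u *\<^sub>R b + v *\<^sub>R b') \<le> u * norm b + v * norm b'"
      using norm_triangle_ineq[of "u *\<^sub>R b" "v *\<^sub>R b'"] uv by simp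
    then have "norm (u *\<^sub>R b + v *\<^sub>R b') / \<delta> \<le> u * (norm b / \<delta>) + v * (norm b' / \<delta>)"
      using \<delta> by (simp add: field_simps)
    moreover have "u * (s + norm b / \<delta>) + v * (s' + norm b' / \<delta>) \<le> u * r + v * r'"
      using p q uv by (intro add_mono mult_left_mono) auto
    ultimately have "((u *\<^sub>R d + v *\<^sub>R d') + (u * s + v * s') *\<^sub>R z + (u *\<^sub>R b + v *\<^sub>R b'), u * r + v * r') \<in> S"
      using p q D by (intro SI) (auto simp: algebra_simps subspace_add subspace_scale)
    then show "u *\<^sub>R p + v *\<^sub>R q \<in> S"
      by (simp add: p q algebra_simps)
  qed
  moreover have "r \<ge> 0" if "(0, r) \<in> S" for r
  proof -
    obtain d s b where *: "d \<in> D" "s + norm b / \<delta> \<le> r" "d + s *\<^sub>R z + b = 0"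
      using \<open>(0, r) \<in> S\<close> by (auto simp: S_def)
    \<comment> \<open>For nonzero \<open>s\<close>, \<open>b\<close> is \<open>s\<close> times the
      difference of a point of \<open>D\<close> and \<open>z\<close>, and that difference has norm
      at least \<open>\<delta>\<close>.\<close>
    have "\<bar>s\<bar> * \<delta> \<le> norm b"
    proof (cases "s = 0")
      case False
      have "\<bar>s\<bar> * \<delta> \<le> \<bar>s\<bar> * norm ((- 1 / s) *\<^sub>R d - z)"
        using * D by (intro mult_left_mono far subspace_scale) auto
      also have "\<dots> = norm (s *\<^sub>R ((- 1 / s) *\<^sub>R d - z))"
        by simp
      also have "s *\<^sub>R ((- 1 / s) *\<^sub>R d - z) = b"
        using False *(3) by (simp add: algebra_simps add_eq_0_iff2)
      finally show ?thesis .
    qed simp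
    then have "\<bar>s\<bar> \<le> norm b / \<delta>"
      using \<delta> by (simp add: field_simps)
    with * show ?thesis by linarith
  qed
  moreover note \<delta>
  moreover have "(x, 1) \<in> S" if "norm x < \<delta>" for x
    using SI[OF D0, of 0 x 1] that \<delta> by simp
  ultimately have "\<exists>f :: 'a \<Rightarrow>\<^sub>L real. \<forall>(x, r)\<in>S. blinfun_apply f x \<le> r"
    by (rule convex_nonvertical_support)
  then obtain f :: "'a \<Rightarrow>\<^sub>L real" where f: "\<And>x r. (x, r) \<in> S \<Longrightarrow> blinfun_apply f x \<le> r"
    by blast
  show ?thesis
  proof (rule that[of f])
    have le: "f d \<le> 0" if "d \<in> D" for d
      using f[OF SI[OF that, of 0 0 0]] by simp
    show "f d = 0" if "d \<in> D" for d
      using le[OF that] le[OF subspace_neg[OF D that]] by (simp add: blinfun.minus_right)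
    show "f z = 1"
      using f[OF SI[OF D0, of 1 0 1]] f[OF SI[OF D0, of "- 1" 0 "- 1"]]
      by (simp add: blinfun.minus_right)
  qed
qed

text \<open>Both bounds on \<open>f\<close> say that it supports the convex hull of
  \<open>C \<times> {1}\<close> and \<open>(- u, - 1)\<close>. A point \<open>(0, r)\<close> of this
  hull with \<open>r < 0\<close> would put a multiple of \<open>u\<close> by a factor above 1 into
  \<open>C\<close>.\<close>

lemma convex_radial_support:
  fixes C :: "'a::real_normed_vector set"
  assumes C: "convex C" and \<rho>: "\<rho> > 0" and ball: "ball 0 \<rho> \<subseteq> C"
    and u: "\<And>\<mu>. \<mu> > 1 \<Longrightarrow> \<mu> *\<^sub>R u \<notin> C"
  obtains f :: "'a \<Rightarrow>\<^sub>L real" where "\<And>c. c \<in> C \<Longrightarrow> blinfun_apply f c \<le> 1" "blinfun_apply f u \<ge> 1"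
proof -
  define S where "S = {(\<alpha> *\<^sub>R k - \<beta> *\<^sub>R u, \<alpha> - \<beta>) | k \<alpha> \<beta>. k \<in> C \<and> \<alpha> \<ge> 0 \<and> \<beta> \<ge> 0 \<and> \<alpha> + \<beta> = 1}"
  have SI: "(\<alpha> *\<^sub>R k - \<beta> *\<^sub>R u, \<alpha> - \<beta>) \<in> S"
    if "k \<in> C" "\<alpha> \<ge> 0" "\<beta> \<ge> 0" "\<alpha> + \<beta> = 1" for k \<alpha> \<beta>
    using that unfolding S_def by blast
  have C0: "0 \<in> C" using ball \<rho> by auto
  have "S = convex hull (insert (- u, - 1) (C \<times> {1}))"
  proof -
    have "convex (C \<times> {1::real})" by (intro convex_Times C) auto
    then have hull: "convex hull (C \<times> {1::real}) = C \<times> {1}" by (rule convex_hull_eq[THEN iffD2])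
    have ne: "C \<times> {1::real} \<noteq> {}" using C0 by blast
    have eq: "(\<alpha> *\<^sub>R k - \<beta> *\<^sub>R u, \<alpha> - \<beta>) = \<beta> *\<^sub>R (- u, - 1) + \<alpha> *\<^sub>R (k, 1)" for k \<alpha> \<beta>
      by simp
    show ?thesis
    proof (intro subset_antisym subsetI)
      fix p assume "p \<in> S"
      then obtain k \<alpha> \<beta> where "k \<in> C" "\<alpha> \<ge> 0" "\<beta> \<ge> 0" "\<beta> + \<alpha> = 1"
        "p = \<beta> *\<^sub>R (- u, - 1) + \<alpha> *\<^sub>R (k, 1)"
        unfolding S_def eq by (auto simp: add.commute)
      then show "p \<in> convex hull (insert (- u, - 1) (C \<times> {1}))"
        unfolding convex_hull_insert[OF ne] hull by blast
    next
      fix p :: "'a \<times> real" assume "p \<in> convex hull (insert (- u, - 1) (C \<times> {1}))"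
      then obtain \<beta> \<alpha> b where p: "\<alpha> \<ge> 0" "\<beta> \<ge> 0" "\<beta> + \<alpha> = 1" "b \<in> C \<times> {1}"
        "p = \<beta> *\<^sub>R (- u, - 1) + \<alpha> *\<^sub>R b"
        unfolding convex_hull_insert[OF ne] hull by blast
      moreover from p obtain k where "k \<in> C" "b = (k, 1)" by blast
      moreover have "\<alpha> + \<beta> = 1" using p by simp
      ultimately show "p \<in> S" unfolding S_def eq by blast
    qed
  qed
  then have "convex S" by (simp add: convex_convex_hull)
  moreover have "r \<ge> 0" if "(0, r) \<in> S" for r
  proof (rule ccontr)
    assume "\<not> r \<ge> 0"
    moreover from that obtain k \<alpha> \<beta>
      where k: "k \<in> C" "\<alpha> \<ge> 0" "r = \<alpha> - \<beta>" "\<alpha> *\<^sub>R k = \<beta> *\<^sub>R u"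
      unfolding S_def by auto
    ultimately have *: "k \<in> C" "\<alpha> \<ge> 0" "\<alpha> < \<beta>" "\<alpha> *\<^sub>R k = \<beta> *\<^sub>R u"
      by auto
    show False
    proof (cases "\<alpha> = 0")
      case True
      with * have "u = 0" by simp
      with u[of 2] C0 show False by simp
    next
      case False
      have "k = (1 / \<alpha>) *\<^sub>R \<alpha> *\<^sub>R k" using False by simp
      also have "\<dots> = (\<beta> / \<alpha>) *\<^sub>R u" unfolding *(4) by simp
      finally show False using u[of "\<beta> / \<alpha>"] * False by simp
    qed
  qed
  moreover note \<rho>
  moreover have kS: "(k, 1) \<in> S" if "k \<in> C" for k
    using SI[OF that, of 1 0] by simp
  then have "(x, 1) \<in> S" if "norm x < \<rho>" for x
    using that ball by auto
  ultimately have "\<exists>f :: 'a \<Rightarrow>\<^sub>L real. \<forall>(x, r)\<in>S. blinfun_apply f x \<le> r"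
    by (rule convex_nonvertical_support)
  then obtain f :: "'a \<Rightarrow>\<^sub>L real" where f: "\<And>x r. (x, r) \<in> S \<Longrightarrow> blinfun_apply f x \<le> r"
    by blast
  have "(- u, - 1) \<in> S"
    using SI[OF C0, of 0 1] by simp
  from f[OF this] have "f u \<ge> 1" by (simp add: blinfun.minus_right)
  with f kS show ?thesis by (intro that) auto
qed

section \<open>Monotone operators, linear relations and normal cones\<close>

text \<open>Adding \<open>(z, zs)\<close> to the graph keeps it monotone, so by maximality it was
  there already.\<close>

lemma maximal_monotone_memI:
  assumes A: "maximal_monotone A"
    and rel: "\<And>a as. (a, as) \<in> gra A \<Longrightarrow> pairing (z - a) (zs - as) \<ge> 0"
  shows "(z, zs) \<in> gra A"
proof -
  define B where "B x = (if x = z then insert zs (A x) else A x)" for x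
  have gra_B: "gra B = insert (z, zs) (gra A)"
    by (auto simp: gra_def B_def split: if_splits)
  have flip: "pairing (a - z) (as - zs) = pairing (z - a) (zs - as)" for a as
    by (simp add: pairing_def blinfun.diff_left blinfun.diff_right)
  have "monotone_op A" using A by (simp add: maximal_monotone_def)
  then have "monotone_op B"
    unfolding monotone_op_def gra_B using rel flip
    by (auto simp: pairing_def)
  with A gra_B show ?thesis
    unfolding maximal_monotone_def by blast
qed

lemma subspace_dom_op:
  assumes "linear_relation A"
  shows "subspace (dom_op A)"
proof -
  have "dom_op A = fst ` gra A"
    by (force simp: dom_op_def gra_def)
  moreover have "linear (fst :: 'a \<times> ('a \<Rightarrow>\<^sub>L real) \<Rightarrow> 'a)"
    by (intro linearI) auto
  ultimately show ?thesis
    using assms by (simp add: linear_relation_def linear_subspace_image)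
qed

lemma monotone_op_sum:
  assumes "monotone_op A" "monotone_op B"
  shows "monotone_op (op_sum A B)"
  unfolding monotone_op_def
proof (intro allI impI)
  fix x xs y ys assume "(x, xs) \<in> gra (op_sum A B) \<and> (y, ys) \<in> gra (op_sum A B)"
  then obtain a b a' b' where *: "xs = a + b" "ys = a' + b'" "(x, a) \<in> gra A" "(x, b) \<in> gra B"
    "(y, a') \<in> gra A" "(y, b') \<in> gra B"
    by (auto simp: gra_def op_sum_def)
  have "pairing (x - y) (xs - ys) = pairing (x - y) (a - a') + pairing (x - y) (b - b')"
    by (simp add: * pairing_def blinfun.diff_left blinfun.add_left)
  with * assms show "pairing (x - y) (xs - ys) \<ge> 0"
    unfolding monotone_op_def by (metis add_nonneg_nonneg)
qed

lemma monotone_normal_cone: "monotone_op (normal_cone C)"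
proof -
  have "pairing (x - y) (xs - ys) \<ge> 0"
    if "xs \<in> normal_cone C x" "ys \<in> normal_cone C y" for x y xs ys
  proof -
    have "pairing (y - x) xs \<le> 0" "pairing (x - y) ys \<le> 0"
      using that by (auto simp: normal_cone_def split: if_splits)
    then show ?thesis
      by (simp add: pairing_def blinfun.diff_left blinfun.diff_right)
  qed
  then show ?thesis by (auto simp: monotone_op_def gra_def)
qed

lemma gra_op_sum_normal_coneI:
  assumes "(a, as) \<in> gra A" "a \<in> C" "\<And>c. c \<in> C \<Longrightarrow> blinfun_apply f (c - a) \<le> 0"
  shows "(a, as + f) \<in> gra (op_sum A (normal_cone C))"
  using assms by (auto simp: gra_def op_sum_def normal_cone_def pairing_def)

lemma nonneg_affine_imp_slope_nonneg:
  fixes \<alpha> \<beta> :: real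
  assumes "\<And>t. t \<ge> 0 \<Longrightarrow> \<alpha> + t * \<beta> \<ge> 0"
  shows "\<beta> \<ge> 0"
proof (rule ccontr)
  assume neg: "\<not> \<beta> \<ge> 0"
  \<comment> \<open>At this \<open>t\<close> the affine function takes the value
    \<open>\<alpha> - \<bar>\<alpha>\<bar> - 1\<close>, which is negative.\<close>
  define t where "t = (\<bar>\<alpha>\<bar> + 1) / (- \<beta>)"
  have "t \<ge> 0" using neg by (simp add: t_def divide_le_0_iff)
  moreover have "t * \<beta> = - (\<bar>\<alpha>\<bar> + 1)" using neg by (simp add: t_def)
  ultimately show False
    using assms[of t] by linarith
qed

section \<open>A point monotonically related to the sum, with 0 interior to \<open>C\<close>\<close>

locale related_point =
  fixes A :: "'a::real_normed_vector \<Rightarrow> ('a \<Rightarrow>\<^sub>L real) set" and C :: "'a set"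
    and z :: 'a and zs :: "'a \<Rightarrow>\<^sub>L real"
  assumes A_maximal: "maximal_monotone A" and A_linear: "linear_relation A"
    and C_closed: "closed C" and C_convex: "convex C" and C_interior: "0 \<in> interior C"
    and related: "\<And>a as. (a, as) \<in> gra (op_sum A (normal_cone C)) \<Longrightarrow> pairing (z - a) (zs - as) \<ge> 0"
begin

lemma gra_subspace: "subspace (gra A)"
  using A_linear by (simp add: linear_relation_def)

lemma gra_0: "(0, 0) \<in> gra A"
  using subspace_0[OF gra_subspace] by (simp add: zero_prod_def)

lemma zero_mem: "0 \<in> C"
  using C_interior interior_subset by blast

text \<open>The zero functional is normal at every point of \<open>C\<close>.\<close>

lemma related_A: "(a, as) \<in> gra A \<Longrightarrow> a \<in> C \<Longrightarrow> pairing (z - a) (zs - as) \<ge> 0"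
  using related gra_op_sum_normal_coneI[of a as A C 0] by simp

text \<open>Since \<open>f a = 0\<close>, the pairing to be tested reduces to
  \<open>pairing a as\<close>, which is nonnegative by monotonicity against
  \<open>(0, 0)\<close>.\<close>

lemma annihilator_mem:
  assumes "\<And>d. d \<in> dom_op A \<Longrightarrow> blinfun_apply f d = 0"
  shows "(0, f) \<in> gra A"
proof (rule maximal_monotone_memI[OF A_maximal])
  fix a as assume a: "(a, as) \<in> gra A"
  then have "f a = 0" by (intro assms) (auto simp: dom_op_def gra_def)
  moreover have "monotone_op A" using A_maximal by (simp add: maximal_monotone_def)
  then have "pairing (a - 0) (as - 0) \<ge> 0"
    using a gra_0 unfolding monotone_op_def by blast
  ultimately show "pairing (0 - a) (f - as) \<ge> 0"
    by (simp add: pairing_def blinfun.diff_left blinfun.minus_right)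
qed

text \<open>Otherwise every multiple \<open>t *\<^sub>R f\<close> of a separating functional lies in
  \<open>A 0\<close>, and relatedness at 0 would bound all \<open>t\<close> by
  \<open>zs z\<close>.\<close>

lemma z_in_closure_dom: "z \<in> closure (dom_op A)"
proof (rule ccontr)
  assume "z \<notin> closure (dom_op A)"
  then obtain f :: "'a \<Rightarrow>\<^sub>L real" where f: "\<And>d. d \<in> dom_op A \<Longrightarrow> blinfun_apply f d = 0" "f z = 1"
    using annihilator_separates[OF subspace_dom_op[OF A_linear]] by blast
  have "pairing (z - 0) (zs - t *\<^sub>R f) \<ge> 0" for t
    by (intro related_A annihilator_mem zero_mem) (simp add: f blinfun.scaleR_left)
  from this[of "zs z + 1"] show False
    by (simp add: pairing_def f blinfun.diff_left blinfun.scaleR_left)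
qed

text \<open>If \<open>z \<notin> C\<close>, a domain point near \<open>z\<close> is scaled down to a boundary point \<open>u\<close> of \<open>C\<close>; a normal
  \<open>f\<close> at \<open>u\<close> satisfies \<open>f (z - u) > 0\<close>, and large multiples of it violate relatedness.\<close>

lemma z_in_C: "z \<in> C"
proof (rule ccontr)
  assume zC: "z \<notin> C"
  obtain \<rho> where \<rho>: "\<rho> > 0" "ball 0 \<rho> \<subseteq> C"
    using C_interior by (auto simp: mem_interior)
  obtain \<epsilon> where \<epsilon>: "\<epsilon> > 0" "ball z \<epsilon> \<subseteq> - C"
    using zC C_closed open_contains_ball[of "- C"] by auto
  \<comment> \<open>Scaling by this \<open>s < 1\<close> moves \<open>z\<close> by at most
    \<open>\<epsilon> / 2\<close>.\<close>
  define s where "s = 1 - \<epsilon> / (2 * (norm z + \<epsilon>))"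
  have s: "0 < s" "s < 1"
    using \<epsilon> norm_ge_zero[of z] by (auto simp: s_def field_simps add_pos_nonneg)
  \<comment> \<open>The first bound keeps \<open>s *\<^sub>R a\<close> outside \<open>C\<close>. The
    second, with the estimate \<open>f x \<le> 2 / \<rho> * norm x\<close> below, yields
    \<open>f (a - z) < 1 / s - 1\<close>.\<close>
  define \<eta> where "\<eta> = min (\<epsilon> / 2) (\<rho> * (1 / s - 1) / 2)"
  have \<eta>: "\<eta> > 0" using \<epsilon> \<rho> s by (simp add: \<eta>_def)
  obtain a where a: "a \<in> dom_op A" "norm (a - z) < \<eta>"
    using z_in_closure_dom \<eta> unfolding closure_approachable dist_norm by blast
  have sa: "s *\<^sub>R a \<notin> C"
  proof -
    have "norm (z - s *\<^sub>R a) \<le> norm (s *\<^sub>R (z - a)) + norm ((1 - s) *\<^sub>R z)"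
      using norm_triangle_ineq[of "s *\<^sub>R (z - a)" "(1 - s) *\<^sub>R z"] by (simp add: algebra_simps)
    also have "\<dots> \<le> norm (a - z) + (1 - s) * norm z"
      using s by (simp add: norm_minus_commute mult_left_le_one_le)
    also have "(1 - s) * norm z \<le> \<epsilon> / 2"
      using \<epsilon> norm_ge_zero[of z] by (simp add: s_def field_simps add_pos_nonneg)
    finally have "norm (z - s *\<^sub>R a) < \<epsilon>" using a(2) by (simp add: \<eta>_def)
    with \<epsilon>(2) show ?thesis by (auto simp: dist_norm)
  qed
  \<comment> \<open>\<open>T\<close> is closed and, by convexity with \<open>0\<close> in
    \<open>C\<close>, bounded by \<open>s\<close>. Its supremum \<open>\<kappa>\<close> marks the
    last point \<open>u\<close> of the ray through \<open>a\<close> that lies in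
    \<open>C\<close>.\<close>
  define T where "T = {t. t \<ge> 0 \<and> t *\<^sub>R a \<in> C}"
  have T_less: "t < s" if "t \<in> T" for t
  proof (rule ccontr)
    assume "\<not> t < s"
    then have "(s / t) *\<^sub>R (t *\<^sub>R a) + (1 - s / t) *\<^sub>R 0 \<in> C"
      using that s zero_mem by (intro convexD[OF C_convex]) (auto simp: T_def)
    with \<open>\<not> t < s\<close> s sa show False by simp
  qed
  have bdd: "bdd_above T" using T_less by (meson bdd_aboveI less_imp_le)
  have "closed T"
  proof -
    have "T = {0..} \<inter> (\<lambda>t. t *\<^sub>R a) -` C" by (auto simp: T_def)
    moreover have "closed ((\<lambda>t. t *\<^sub>R a) -` C)"
      by (intro closed_vimage C_closed continuous_intros)
    ultimately show ?thesis by (simp add: closed_Int)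
  qed
  moreover have "T \<noteq> {}" using zero_mem by (auto simp: T_def)
  ultimately have "Sup T \<in> T" using bdd closed_contains_Sup by blast
  define \<kappa> where "\<kappa> = Sup T"
  define u where "u = \<kappa> *\<^sub>R a"
  have u: "u \<in> C" "\<kappa> < s" "\<kappa> \<ge> 0"
    using \<open>Sup T \<in> T\<close> T_less by (auto simp: T_def u_def \<kappa>_def)
  have "\<kappa> > 0"
  proof -
    \<comment> \<open>A small multiple of \<open>a\<close> lies in the ball inside \<open>C\<close>;
      the added 1 rules out division by zero.\<close>
    define w where "w = \<rho> / 2 / (norm a + 1)"
    have na: "norm a + 1 > 0" by (simp add: add_nonneg_pos)
    have "w > 0" using \<rho> na by (simp add: w_def)
    have "w * (norm a + 1) = \<rho> / 2" 
      unfolding w_def by (rule nonzero_eq_divide_eq[THEN iffD1]) (use na in auto)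
    with \<open>w > 0\<close> \<rho> have "w * norm a < \<rho>" by (simp add: distrib_left)
    with \<open>w > 0\<close> have "w *\<^sub>R a \<in> ball 0 \<rho>" by simp
    with \<rho> \<open>w > 0\<close> have "w \<in> T" by (auto simp: T_def)
    then have "w \<le> \<kappa>" unfolding \<kappa>_def using bdd by (rule cSup_upper)
    with \<open>w > 0\<close> show ?thesis by linarith
  qed
  have "\<mu> *\<^sub>R u \<notin> C" if "\<mu> > 1" for \<mu>
  proof
    assume "\<mu> *\<^sub>R u \<in> C"
    then have "\<mu> * \<kappa> \<in> T" using that \<open>\<kappa> > 0\<close> by (simp add: T_def u_def)
    then have "\<mu> * \<kappa> \<le> \<kappa>" unfolding \<kappa>_def using bdd by (rule cSup_upper)
    with that \<open>\<kappa> > 0\<close> show False by simp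
  qed
  then obtain f :: "'a \<Rightarrow>\<^sub>L real"
    where f: "\<And>c. c \<in> C \<Longrightarrow> blinfun_apply f c \<le> 1" "f u \<ge> 1"
    using convex_radial_support[OF C_convex \<rho>] by blast
  have f_norm: "f x \<le> 2 / \<rho> * norm x" for x
  proof (cases "x = 0")
    case False
    then have "(\<rho> / (2 * norm x)) *\<^sub>R x \<in> ball 0 \<rho>" using \<rho> by simp
    with \<rho> f(1) have "f ((\<rho> / (2 * norm x)) *\<^sub>R x) \<le> 1" by blast
    then show ?thesis
      using False \<rho> by (simp add: blinfun.scaleR_right field_simps)
  qed simp
  \<comment> \<open>Write \<open>f (z - u) = (f a - f u) - f (a - z)\<close>. As
    \<open>u = \<kappa> *\<^sub>R a\<close>, the first term is at least
    \<open>1 / \<kappa> - 1\<close>, and \<open>\<kappa> < s\<close> makes this beat the error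
    \<open>f (a - z) < 1 / s - 1\<close>.\<close>
  have "f (z - u) > 0"
  proof -
    have "f (a - z) \<le> 2 / \<rho> * norm (a - z)" by (rule f_norm)
    also have "\<dots> < 2 / \<rho> * \<eta>"
      using a \<rho> by (intro mult_strict_left_mono) auto
    also have "\<dots> \<le> 2 / \<rho> * (\<rho> * (1 / s - 1) / 2)"
      unfolding \<eta>_def using \<rho> by (intro mult_left_mono min.cobounded2) auto
    also have "\<dots> = 1 / s - 1" using \<rho> by simp
    also have "\<dots> \<le> 1 / \<kappa> - 1" using u \<open>\<kappa> > 0\<close> s by (simp add: frac_le)
    also have "\<dots> \<le> (1 / \<kappa> - 1) * f u"
      using f(2) u s \<open>\<kappa> > 0\<close> mult_left_mono[of 1 "f u" "1 / \<kappa> - 1"] by simp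
    also have "\<dots> = f a - f u"
      using \<open>\<kappa> > 0\<close> by (simp add: u_def blinfun.scaleR_right algebra_simps)
    finally show ?thesis by (simp add: blinfun.diff_right)
  qed
  have "u \<in> dom_op A"
    unfolding u_def by (rule subspace_scale[OF subspace_dom_op[OF A_linear] a(1)])
  then obtain us where us: "(u, us) \<in> gra A" by (auto simp: dom_op_def gra_def)
  \<comment> \<open>For \<open>t \<ge> 0\<close> the functional \<open>t *\<^sub>R f\<close> is
    normal at \<open>u\<close>, because \<open>f\<close> is at most 1 on \<open>C\<close> and at
    least 1 at \<open>u\<close>.\<close>
  have "pairing (z - u) (zs - us) + t * (- f (z - u)) \<ge> 0" if "t \<ge> 0" for t
  proof -
    have "(u, us + t *\<^sub>R f) \<in> gra (op_sum A (normal_cone C))"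
    proof (rule gra_op_sum_normal_coneI[OF us u(1)])
      fix c assume "c \<in> C"
      then have "f (c - u) \<le> 0" using f(1)[of c] f(2) by (simp add: blinfun.diff_right)
      with that show "(t *\<^sub>R f) (c - u) \<le> 0"
        by (simp add: blinfun.scaleR_left mult_nonneg_nonpos)
    qed
    from related[OF this] show ?thesis
      by (simp add: pairing_def blinfun.diff_left blinfun.add_left blinfun.scaleR_left)
  qed
  then have "- f (z - u) \<ge> 0" by (rule nonneg_affine_imp_slope_nonneg)
  with \<open>f (z - u) > 0\<close> show False by simp
qed

lemma mem_sum: "(z, zs) \<in> gra (op_sum A (normal_cone C))"
proof -
  define S where "S = {(c - a, r) | c a as r. c \<in> C \<and> (a, as) \<in> gra A \<and> pairing (z - a) (zs - as) \<le> r}"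
  have mono: "monotone_op A" using A_maximal by (simp add: maximal_monotone_def)
  have "convex S"
  proof (rule convexI)
    fix p q u v assume "p \<in> S" "q \<in> S" and uv: "0 \<le> u" "0 \<le> v" "u + v = (1::real)"
    then obtain c a as r c' a' as' r' where
      p: "p = (c - a, r)" "c \<in> C" "(a, as) \<in> gra A" "pairing (z - a) (zs - as) \<le> r" and
      q: "q = (c' - a', r')" "c' \<in> C" "(a', as') \<in> gra A" "pairing (z - a') (zs - as') \<le> r'"
      by (auto simp: S_def)
    let ?a = "u *\<^sub>R a + v *\<^sub>R a'" and ?as = "u *\<^sub>R as + v *\<^sub>R as'"
    have "u *\<^sub>R (a, as) + v *\<^sub>R (a', as') \<in> gra A"
      using p q by (intro subspace_add subspace_scale gra_subspace)
    then have gra: "(?a, ?as) \<in> gra A" by simp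
    have v: "v = 1 - u" using uv by simp
    \<comment> \<open>The quadratic part leaves a correction whose sign is fixed by monotonicity of
      \<open>A\<close>; this makes the height convex along \<open>gra A\<close>.\<close>
    have "pairing (z - ?a) (zs - ?as) = u * pairing (z - a) (zs - as) + v * pairing (z - a') (zs - as')
        - u * v * pairing (a - a') (as - as')"
      unfolding v by (simp add: pairing_def blinfun.bilinear_simps algebra_simps)
    also have "\<dots> \<le> u * pairing (z - a) (zs - as) + v * pairing (z - a') (zs - as')"
      using mono p q uv by (simp add: monotone_op_def)
    also have "\<dots> \<le> u * r + v * r'"
      using p q uv by (intro add_mono mult_left_mono) auto
    finally have "((u *\<^sub>R c + v *\<^sub>R c') - ?a, u * r + v * r') \<in> S"
      using gra convexD[OF C_convex p(2) q(2) uv] by (auto simp: S_def)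
    then show "u *\<^sub>R p + v *\<^sub>R q \<in> S"
      by (simp add: p q algebra_simps)
  qed
  \<comment> \<open>A point of \<open>S\<close> over 0 has \<open>a = c\<close>, so \<open>a\<close>
    lies in \<open>C\<close> and relatedness applies.\<close>
  moreover have "r \<ge> 0" if "(0, r) \<in> S" for r
    using that related_A by (fastforce simp: S_def)
  moreover obtain \<rho> where \<rho>: "\<rho> > 0" "ball 0 \<rho> \<subseteq> C"
    using C_interior by (auto simp: mem_interior)
  note \<rho>(1)
  \<comment> \<open>Take \<open>c = x\<close> and the graph point \<open>(0, 0)\<close>: the height
    is the same for all \<open>x\<close> in the ball.\<close>
  moreover have "(x, pairing z zs) \<in> S" if "norm x < \<rho>" for x
  proof -
    have "x \<in> C" using that \<rho> by auto
    then show ?thesis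
      unfolding S_def using gra_0
      by (intro CollectI exI[of _ x] exI[of _ 0] exI[of _ "pairing z zs"]) simp
  qed
  ultimately have "\<exists>f :: 'a \<Rightarrow>\<^sub>L real. \<forall>(x, r)\<in>S. blinfun_apply f x \<le> r"
    by (rule convex_nonvertical_support)
  then obtain f :: "'a \<Rightarrow>\<^sub>L real" where f: "\<And>x r. (x, r) \<in> S \<Longrightarrow> blinfun_apply f x \<le> r"
    by blast
  have f_le: "f (c - a) \<le> pairing (z - a) (zs - as)" if "c \<in> C" "(a, as) \<in> gra A" for c a as
    using that by (intro f) (auto simp: S_def)
  have "(z, zs - f) \<in> gra A"
  proof (rule maximal_monotone_memI[OF A_maximal])
    fix a as assume "(a, as) \<in> gra A"
    from f_le[OF z_in_C this] show "pairing (z - a) (zs - f - as) \<ge> 0"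
      by (simp add: pairing_def blinfun.diff_left)
  qed
  moreover have "f (c - z) \<le> 0" if "c \<in> C" for c
    using f_le[OF that \<open>(z, zs - f) \<in> gra A\<close>] by (simp add: pairing_def)
  ultimately have "(z, (zs - f) + f) \<in> gra (op_sum A (normal_cone C))"
    by (intro gra_op_sum_normal_coneI z_in_C)
  then show ?thesis by simp
qed

end

section \<open>Reduction to 0 interior to \<open>C\<close> by translation, and maximality\<close>

theorem theorem3p1:
  fixes A :: "'a::banach \<Rightarrow> ('a \<Rightarrow>\<^sub>L real) set"
    and C :: "'a set"
  assumes "maximal_monotone A"
    and "linear_relation A"
    and "C \<noteq> {}" and "closed C" and "convex C"
    and "dom_op A \<inter> interior C \<noteq> {}"
  shows "maximal_monotone (op_sum A (normal_cone C))"
proof -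
  let ?N = "op_sum A (normal_cone C)"
  obtain x xs where x: "(x, xs) \<in> gra A" "x \<in> interior C"
    using assms(6) by (auto simp: dom_op_def gra_def)
  let ?C = "(\<lambda>c. c - x) ` C"
  have sub: "subspace (gra A)" using assms(2) by (simp add: linear_relation_def)
  have cone: "normal_cone ?C (y - x) = normal_cone C y" for y
    by (auto simp: normal_cone_def)
  \<comment> \<open>\<open>gra A\<close> is a subspace containing \<open>(x, xs)\<close>, hence invariant under this translation.\<close>
  have gra_A: "(y - x, ys - xs) \<in> gra A \<longleftrightarrow> (y, ys) \<in> gra A" for y ys
    using subspace_add[OF sub _ x(1), of "(y - x, ys - xs)"] subspace_diff[OF sub _ x(1), of "(y, ys)"]
    by auto
  have gra_N: "(y - x, ys - xs) \<in> gra (op_sum A (normal_cone ?C)) \<longleftrightarrow> (y, ys) \<in> gra ?N" for y ys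
  proof -
    \<comment> \<open>Moving the normal part \<open>b\<close> to the other side expresses the sum
      through \<open>gra A\<close>, whose translation invariance then applies.\<close>
    have gra_sum: "(u, us) \<in> gra (op_sum A B) \<longleftrightarrow> (\<exists>b\<in>B u. (u, us - b) \<in> gra A)" for u us B
    proof -
      have "us = as + b \<longleftrightarrow> as = us - b" for as b by (simp only: eq_diff_eq eq_commute)
      then show ?thesis unfolding gra_def op_sum_def by simp blast
    qed
    have "(y - x, ys - xs - b) \<in> gra A \<longleftrightarrow> (y, ys - b) \<in> gra A" for b
      using gra_A[of y "ys - b"] by (simp add: algebra_simps)
    then show ?thesis
      by (simp only: gra_sum cone)
  qed
  \<comment> \<open>This is maximality in pointwise form: each point of a monotone extension of
    \<open>?N\<close> is related to all of \<open>gra ?N\<close>.\<close>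
  have main: "(z, zs) \<in> gra ?N"
    if rel: "\<And>a as. (a, as) \<in> gra ?N \<Longrightarrow> pairing (z - a) (zs - as) \<ge> 0" for z zs
  proof -
    \<comment> \<open>Relatedness depends only on differences, so it survives the translation;
      \<open>mem_sum\<close> is then translated back by \<open>gra_N\<close>.\<close>
    interpret related_point A ?C "z - x" "zs - xs"
    proof
      show "closed ?C" "convex ?C"
        using assms(4,5) by (auto intro: closed_translation_subtract convex_translation_subtract)
      show "0 \<in> interior ?C"
        using x(2) by (auto simp: interior_translation_subtract)
      show "pairing (z - x - a) (zs - xs - as) \<ge> 0"
        if "(a, as) \<in> gra (op_sum A (normal_cone ?C))" for a as
        using that gra_N[of "a + x" "as + xs"] rel[of "a + x" "as + xs"] by (simp add: algebra_simps)
    qed (use assms in auto)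
    show ?thesis using mem_sum gra_N by blast
  qed
  have "monotone_op ?N"
    using assms(1) by (intro monotone_op_sum monotone_normal_cone) (simp add: maximal_monotone_def)
  moreover have "gra B \<subseteq> gra ?N" if "monotone_op B" "gra ?N \<subseteq> gra B" for B
  proof clarify
    fix z zs assume "(z, zs) \<in> gra B"
    with that have "pairing (z - a) (zs - as) \<ge> 0" if "(a, as) \<in> gra ?N" for a as
      using \<open>(a, as) \<in> gra ?N\<close> unfolding monotone_op_def by blast
    then show "(z, zs) \<in> gra ?N" by (rule main)
  qed
  ultimately show ?thesis
    unfolding maximal_monotone_def by blast
qed

end
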